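(* Let $\{x_t\}$ be generated by the M-CRM (Algorithm 1) and assume that, for every $j\in\mathcal J$ and $t\ge1$, $\nabla\bar F_j(x_t)=\nabla F_j(x_t)$ and $\nabla^2\bar F_j(x_t)=\nabla^2F_j(x_t)$. Moreover, assume that (A1)–(A3) hold, and let $x^*$ be the limit of $\{x_t\}$ (under these assumptions $\{x_t\}$ converges). Then there exists $D>0$ such that, for all $t$ sufficiently large, $$\|x_{t+1}-x^*\|\le D\|x_t-x^*\|^2.$$
   Context: Setting: $F=(F_1,\dots,F_m):\mathbb R^n\to\mathbb R^m$ is twice continuously differentiable, $\mathcal J=\{1,\dots,m\}$; $\|\cdot\|$ is the Euclidean norm and the induced operator norm. (A1): for every $j\in\mathcal J$, $\|\nabla^2F_j(y)-\nabla^2F_j(z)\|\le L_j\|y-z\|$ for all $y,z\in\mathbb R^n$; $L:=\max_{j}L_j$. (A2): for every $j\in\mathcal J$ there is $F_j^*\in\mathbb R$ with $F_j(y)\ge F_j^*$ for all $y$. (A3): there exist $\mu>0$ and an index $t_0$ such that, for every $j\in\mathcal J$, $\nabla^2F_j(x)\succeq\mu I$ whenever $F_j(x)\le F_j(x_{t_0})+\frac{\sigma_1}{12}\|x_1-x_0\|^3$. Given approximations $\nabla\bar F_j(x)\in\mathbb R^n$ of $\nabla F_j(x)$ and symmetric $\nabla^2\bar F_j(x)\in\mathbb R^{n\times n}$ of $\nabla^2F_j(x)$, set $E^G_j(x):=\nabla F_j(x)-\nabla\bar F_j(x)$, $E^H_j(x):=\nabla^2F_j(x)-\nabla^2\bar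 F_j(x)$, and for $\sigma>0$ $$M^j_{x,\sigma}(y):=\langle\nabla\bar F_j(x),y-x\rangle+\tfrac12\langle\nabla^2\bar F_j(x)(y-x),y-x\rangle+\tfrac{\sigma}{6}\|y-x\|^3,\qquad M_{x,\sigma}(y):=\max_{j\in\mathcal J}M^j_{x,\sigma}(y).$$ Algorithm 1 (M-CRM). Step 0: choose $x_0,x_1\in\mathbb R^n$, $\sigma_1>0$, $\theta\ge0$, $\alpha>1$, $\bar\kappa_G,\bar\kappa_H\ge0$; set $t:=1$. Step 1: let $i\ge0$ be the smallest integer with $\alpha^{i-1}\sigma_t\ge\sigma_1$. Step 1.1: for every $j$ choose $\nabla\bar F_j(x_t),\nabla^2\bar F_j(x_t)$ with $\|E^G_j(x_t)\|\le\frac{\bar\kappa_G}{\alpha^{i-1}}\|x_t-x_{t-1}\|^2$ and $\|E^H_j(x_t)\|\le\frac{\bar\kappa_H}{\alpha^{i-1}}\|x_t-x_{t-1}\|$. Step 1.2: compute $(x^+_{t,i},\lambda^+_{t,i})\in\mathbb R^n\times\mathbb R^m_+$ with $M_{x_t,\alpha^i\sigma_t}(x^+_{t,i})\le0$, $\sum_j(\lambda^+_{t,i})_j=1$, and $\big\|\sum_j(\lambda^+_{t,i})_j\nabla M^j_{x_t,\alpha^i\sigma_t}(x^+_{t,i})\big\|\le\theta\|x^+_{t,i}-x_t\|^2$. Step 1.3: if $F_j(x_t)-F_j(x^+_{t,i})\ge\frac{\alpha^i\sigma_t}{12}\|x^+_{t,i}-x_t\|^3-\frac{\sigma_t}{12}\|x_t-x_{t-1}\|^3$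 for all $j\in\mathcal J$, set $i_t=i$ and go to Step 2; otherwise set $i:=i+1$ and go to Step 1.1. Step 2: set $x_{t+1}=x^+_{t,i_t}$, $\lambda_{t+1}=\lambda^+_{t,i_t}$, $\sigma_{t+1}=\alpha^{i_t-1}\sigma_t$, $t:=t+1$, and go to Step 1.
   Formalization: In (A3) the index t_0 is additionally required to satisfy t_0 ≥ 1 and σ_{t_0}‖x_{t_0}−x_{t_0−1}‖³ ≤ σ_1‖x_1−x_0‖³ (automatic for t_0 = 1); for arbitrary t_0 the iterates can leave the level sets and the claim fails. *)

theory Defs
  imports "HOL-Analysis.Analysis"
begin

definition gradient :: "(real^'n \<Rightarrow> real) \<Rightarrow> real^'n \<Rightarrow> real^'n" where
  "gradient f x = (THE D. GDERIV f x :> D)"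

definition hessian :: "(real^'n \<Rightarrow> real) \<Rightarrow> real^'n \<Rightarrow> real^'n^'n" where
  "hessian f x = jacobian (gradient f) (at x)"

definition twice_cont_diff :: "(real^'n \<Rightarrow> real) \<Rightarrow> bool" where
  "twice_cont_diff f \<longleftrightarrow>
     (\<forall>x. f differentiable (at x)) \<and>
     (\<forall>x. gradient f differentiable (at x)) \<and>
     continuous_on UNIV (hessian f)"

(* \<open>norm A\<close> on the type real^'n^'n is the Frobenius norm, hence a separate
   operator norm. *)
definition opnorm :: "real^'n^'n \<Rightarrow> real" where
  "opnorm A = onorm ((*v) A)"

definition loewner_le :: "real^'n^'n \<Rightarrow> real^'n^'n \<Rightarrow> bool" where
  "loewner_le A B \<longleftrightarrow> (\<forall>v. v \<bullet> (A *v v) \<le> v \<bullet> (B *v v))"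

definition obj :: "(real^'n \<Rightarrow> real^'m) \<Rightarrow> 'm \<Rightarrow> real^'n \<Rightarrow> real" where
  "obj F j = (\<lambda>y. F y $ j)"

definition A1 :: "(real^'n \<Rightarrow> real^'m) \<Rightarrow> ('m \<Rightarrow> real) \<Rightarrow> bool" where
  "A1 F L \<longleftrightarrow>
     (\<forall>j y z. opnorm (hessian (obj F j) y - hessian (obj F j) z) \<le> L j * norm (y - z))"

definition A2 :: "(real^'n \<Rightarrow> real^'m) \<Rightarrow> bool" where
  "A2 F \<longleftrightarrow> (\<forall>j. \<exists>Fstar. \<forall>y. obj F j y \<ge> Fstar)"

(* \<open>mat \<mu>\<close> is \<mu> times the identity matrix.  The level of \<open>obj F j\<close> used here bounds the
   iterates from \<open>t0\<close> on when \<open>t0 = 1\<close>, and more generally when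
   \<open>\<sigma> t0 * norm (x t0 - x (t0 - 1)) ^ 3 \<le> \<sigma> 1 * norm (x 1 - x 0) ^ 3\<close> with \<open>t0 \<ge> 1\<close>; for an
   unrestricted \<open>t0\<close> the iterates may leave the set and quadratic convergence can fail,
   so the theorem states this as a separate requirement on \<open>t0\<close>. *)
definition A3 ::
  "(real^'n \<Rightarrow> real^'m) \<Rightarrow> (nat \<Rightarrow> real^'n) \<Rightarrow> (nat \<Rightarrow> real) \<Rightarrow> real \<Rightarrow> nat \<Rightarrow> bool" where
  "A3 F x \<sigma> \<mu> t0 \<longleftrightarrow>
     (\<forall>j y. obj F j y \<le> obj F j (x t0) + \<sigma> 1 / 12 * norm (x 1 - x 0) ^ 3
        \<longrightarrow> loewner_le (mat \<mu>) (hessian (obj F j) y))"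

(* In the next two definitions \<open>g\<close>, \<open>H\<close> stand for the approximate gradient and Hessian
   at \<open>x\<close> (indexed by the objectives in the second one). *)
definition cubic_model ::
  "real^'n \<Rightarrow> real^'n^'n \<Rightarrow> real^'n \<Rightarrow> real \<Rightarrow> real^'n \<Rightarrow> real" where
  "cubic_model g H x s y =
     g \<bullet> (y - x) + 1 / 2 * ((H *v (y - x)) \<bullet> (y - x)) + s / 6 * norm (y - x) ^ 3"

definition max_model ::
  "('m::finite \<Rightarrow> real^'n) \<Rightarrow> ('m \<Rightarrow> real^'n^'n) \<Rightarrow> real^'n \<Rightarrow> real \<Rightarrow> real^'n \<Rightarrow> real" where
  "max_model g H x s y = Max (range (\<lambda>j. cubic_model (g j) (H j) x s y))"

definition first_trial :: "real \<Rightarrow> (nat \<Rightarrow> real) \<Rightarrow> nat \<Rightarrow> nat" where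
  "first_trial \<alpha> \<sigma> t = (LEAST i. \<alpha> powi (int i - 1) * \<sigma> t \<ge> \<sigma> 1)"

(* Step 1.1; \<open>c\<close> is the factor \<alpha>^(i-1) and \<open>x'\<close> the previous iterate. *)
definition approx_step ::
  "(real^'n \<Rightarrow> real^'m) \<Rightarrow> real \<Rightarrow> real \<Rightarrow> real \<Rightarrow> real^'n \<Rightarrow> real^'n
     \<Rightarrow> ('m \<Rightarrow> real^'n) \<Rightarrow> ('m \<Rightarrow> real^'n^'n) \<Rightarrow> bool" where
  "approx_step F \<kappa>G \<kappa>H c x' x g H \<longleftrightarrow>
     (\<forall>j. transpose (H j) = H j \<and>
          norm (gradient (obj F j) x - g j) \<le> \<kappa>G / c * norm (x - x') ^ 2 \<and>
          opnorm (hessian (obj F j) x - H j) \<le> \<kappa>H / c * norm (x - x'))"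

(* Step 1.2; \<open>s\<close> is the regularization parameter \<alpha>^i \<sigma>_t. *)
definition subproblem_step ::
  "real \<Rightarrow> real^'n \<Rightarrow> real \<Rightarrow> ('m::finite \<Rightarrow> real^'n) \<Rightarrow> ('m \<Rightarrow> real^'n^'n)
     \<Rightarrow> real^'n \<Rightarrow> real^'m \<Rightarrow> bool" where
  "subproblem_step \<theta> x s g H xp lp \<longleftrightarrow>
     max_model g H x s xp \<le> 0 \<and>
     (\<forall>j. lp $ j \<ge> 0) \<and> (\<Sum>j\<in>UNIV. lp $ j) = 1 \<and>
     norm (\<Sum>j\<in>UNIV. lp $ j *\<^sub>R gradient (cubic_model (g j) (H j) x s) xp)
       \<le> \<theta> * norm (xp - x) ^ 2"

(* The test of Step 1.3; \<open>s\<close> is the trial parameter \<alpha>^i \<sigma>_t and \<open>s'\<close> is \<sigma>_t. *)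
definition accepted ::
  "(real^'n \<Rightarrow> real^'m) \<Rightarrow> real^'n \<Rightarrow> real^'n \<Rightarrow> real \<Rightarrow> real \<Rightarrow> real^'n \<Rightarrow> bool" where
  "accepted F x' x s' s xp \<longleftrightarrow>
     (\<forall>j. obj F j x - obj F j xp
            \<ge> s / 12 * norm (xp - x) ^ 3 - s' / 12 * norm (x - x') ^ 3)"

(* The sequences form an infinite run of the algorithm.  \<open>it t\<close> is the accepted inner index
   \<open>i_t\<close>; \<open>g t i\<close>, \<open>H t i\<close>, \<open>xp t i\<close>, \<open>lp t i\<close> are what the algorithm chooses in trial \<open>i\<close> of
   outer iteration \<open>t\<close>.  They are constrained only for the trials that are actually run,
   namely \<open>first_trial \<alpha> \<sigma> t \<le> i \<le> it t\<close>; the values \<open>\<sigma> 0\<close>, \<open>lam 0\<close>, \<open>lam 1\<close> play no role. *)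
definition M_CRM ::
  "(real^'n \<Rightarrow> real^'m) \<Rightarrow> real \<Rightarrow> real \<Rightarrow> real \<Rightarrow> real
     \<Rightarrow> (nat \<Rightarrow> real^'n) \<Rightarrow> (nat \<Rightarrow> real^'m) \<Rightarrow> (nat \<Rightarrow> real) \<Rightarrow> (nat \<Rightarrow> nat)
     \<Rightarrow> (nat \<Rightarrow> nat \<Rightarrow> 'm \<Rightarrow> real^'n) \<Rightarrow> (nat \<Rightarrow> nat \<Rightarrow> 'm \<Rightarrow> real^'n^'n)
     \<Rightarrow> (nat \<Rightarrow> nat \<Rightarrow> real^'n) \<Rightarrow> (nat \<Rightarrow> nat \<Rightarrow> real^'m) \<Rightarrow> bool" where
  "M_CRM F \<theta> \<alpha> \<kappa>G \<kappa>H x lam \<sigma> it g H xp lp \<longleftrightarrow>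
     \<sigma> 1 > 0 \<and> \<theta> \<ge> 0 \<and> \<alpha> > 1 \<and> \<kappa>G \<ge> 0 \<and> \<kappa>H \<ge> 0 \<and>
     (\<forall>t\<ge>1.
        first_trial \<alpha> \<sigma> t \<le> it t \<and>
        (\<forall>i\<in>{first_trial \<alpha> \<sigma> t..it t}.
           approx_step F \<kappa>G \<kappa>H (\<alpha> powi (int i - 1)) (x (t - 1)) (x t) (g t i) (H t i) \<and>
           subproblem_step \<theta> (x t) (\<alpha> ^ i * \<sigma> t) (g t i) (H t i) (xp t i) (lp t i) \<and>
           (accepted F (x (t - 1)) (x t) (\<sigma> t) (\<alpha> ^ i * \<sigma> t) (xp t i) \<longleftrightarrow> i = it t)) \<and>
        x (t + 1) = xp t (it t) \<and>
        lam (t + 1) = lp t (it t) \<and>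
        \<sigma> (t + 1) = \<alpha> powi (int (it t) - 1) * \<sigma> t)"

end

theory Submission
  imports Defs
begin

text \<open>
  Write \<open>d t = x (t + 1) - x t\<close>. The energy \<open>obj F j (x t) + \<sigma> t / 12 * norm (d (t - 1)) ^ 3\<close>
  decreases by at least a constant times \<open>norm (d t) ^ 3\<close>, so \<open>d\<close> tends to 0 and the iterates
  from \<open>t0\<close> on stay where all Hessians dominate \<open>\<mu> I\<close>; moreover \<open>\<sigma>\<close> is bounded. The multipliers of
  step \<open>t\<close> give a convex combination of the true gradients at \<open>x (t + 1)\<close> of norm \<open>O(norm (d t) ^ 2)\<close>.
  Averaging the inequalities saying that the models at \<open>x (t + 1)\<close> are nonpositive at \<open>x (t + 2)\<close> with
  these same multipliers yields \<open>norm (d (t + 1)) = O(norm (d t) ^ 2)\<close>. So the steps themselves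
  converge quadratically, which gives both the existence of the limit and the rate; no convexity of
  the level sets is needed.
\<close>

section \<open>Gradients and Hessians as derivatives, in particular along lines\<close>

lemma gradient_eqI:
  assumes "GDERIV f x :> D"
  shows "gradient f x = D"
  unfolding gradient_def
proof (rule the_equality[where P = "\<lambda>D. GDERIV f x :> D"])
  fix E assume "GDERIV f x :> E"
  then have "(\<lambda>h. h \<bullet> E) = (\<lambda>h. h \<bullet> D)"
    using assms unfolding gderiv_def by (rule has_derivative_unique)
  then have "\<forall>h. h \<bullet> E = h \<bullet> D" by (simp add: fun_eq_iff)
  then show "E = D" by (rule vector_eq_ldot[THEN iffD1])
qed (rule assms)

text \<open>\<open>gradient\<close> is a definite description, so it needs a witness: a linear
  functional on a Euclidean space is the inner product with the vector of its values on
  \<open>Basis\<close>.\<close>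

lemma gderiv_gradient:
  fixes f :: "real^'n \<Rightarrow> real"
  assumes "f differentiable (at x)"
  shows "GDERIV f x :> gradient f x"
proof -
  obtain A where A: "(f has_derivative A) (at x)"
    using assms unfolding differentiable_def by blast
  interpret A: bounded_linear A using A by (rule has_derivative_bounded_linear)
  have "A h = h \<bullet> (\<Sum>b\<in>Basis. A b *\<^sub>R b)" for h
  proof -
    have "A h = A (\<Sum>b\<in>Basis. (h \<bullet> b) *\<^sub>R b)" by (simp add: euclidean_representation)
    also have "\<dots> = (\<Sum>b\<in>Basis. (h \<bullet> b) * A b)" by (simp add: A.sum A.scaleR)
    also have "\<dots> = h \<bullet> (\<Sum>b\<in>Basis. A b *\<^sub>R b)" by (simp add: inner_sum_right mult.commute)
    finally show ?thesis .
  qed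
  then have "A = (\<lambda>h. h \<bullet> (\<Sum>b\<in>Basis. A b *\<^sub>R b))" by (rule ext)
  then have "GDERIV f x :> (\<Sum>b\<in>Basis. A b *\<^sub>R b)"
    unfolding gderiv_def by (rule has_derivative_eq_rhs[OF A])
  then show ?thesis using gradient_eqI[of f x] by simp
qed

lemma gradient_along_line:
  fixes f :: "real^'n \<Rightarrow> real"
  assumes "f differentiable (at (x + r *\<^sub>R d))"
  shows "((\<lambda>s. f (x + s *\<^sub>R d)) has_real_derivative (d \<bullet> gradient f (x + r *\<^sub>R d))) (at r)"
proof -
  have f: "(f has_derivative (\<lambda>h. h \<bullet> gradient f (x + r *\<^sub>R d))) (at (x + r *\<^sub>R d))"
    using gderiv_gradient[OF assms] unfolding gderiv_def .
  have l: "((\<lambda>s. x + s *\<^sub>R d) has_derivative (\<lambda>h. h *\<^sub>R d)) (at r)"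
    by (auto intro!: derivative_eq_intros)
  show ?thesis
    using has_derivative_compose[OF l f]
    unfolding has_field_derivative_def by (simp add: mult.commute[of _ "_ \<bullet> _"])
qed

lemma hessian_along_line:
  fixes f :: "real^'n \<Rightarrow> real"
  assumes "gradient f differentiable (at (x + r *\<^sub>R d))"
  shows "((\<lambda>s. u \<bullet> gradient f (x + s *\<^sub>R d)) has_real_derivative
           (u \<bullet> (hessian f (x + r *\<^sub>R d) *v d))) (at r)"
proof -
  have f: "(gradient f has_derivative (*v) (hessian f (x + r *\<^sub>R d))) (at (x + r *\<^sub>R d))"
    using assms unfolding hessian_def by (simp add: jacobian_works)
  have l: "((\<lambda>s. x + s *\<^sub>R d) has_derivative (\<lambda>h. h *\<^sub>R d)) (at r)"
    by (auto intro!: derivative_eq_intros)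
  show ?thesis
    using has_derivative_inner_right[OF has_derivative_compose[OF l f], of u]
    unfolding has_field_derivative_def
    by (simp add: matrix_vector_mult_scaleR mult.commute[of _ "_ \<bullet> _"])
qed

section \<open>Taylor bounds from a Lipschitz Hessian\<close>

lemma norm_matrix_vector_le_opnorm: "norm (A *v v) \<le> opnorm A * norm v"
  unfolding opnorm_def by (rule onorm) (rule matrix_vector_mul_bounded_linear)

lemma opnorm_nonneg: "0 \<le> opnorm A"
  unfolding opnorm_def by (rule onorm_pos_le) (rule matrix_vector_mul_bounded_linear)

text \<open>Testing against a fixed \<open>u\<close> leaves a scalar function on the segment, so a
  monotonicity argument replaces integration of the Hessian.\<close>

lemma hessian_lipschitz_gradient_inner:
  fixes f :: "real^'n \<Rightarrow> real"
  assumes f: "\<And>y. gradient f differentiable (at y)"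
    and lip: "\<And>y z. opnorm (hessian f y - hessian f z) \<le> L * norm (y - z)"
  shows "u \<bullet> (gradient f (x + d) - gradient f x - hessian f x *v d) \<le> L / 2 * norm d ^ 2 * norm u"
proof -
  \<comment> \<open>The quadratic term in \<open>s\<close> has as derivative exactly the Lipschitz
    bound on the change of the Hessian term from \<open>x\<close> to
    \<open>x + s *\<^sub>R d\<close>, which makes \<open>?h\<close> nonincreasing.\<close>
  let ?h = "\<lambda>s. u \<bullet> gradient f (x + s *\<^sub>R d) - s * (u \<bullet> (hessian f x *v d)) - L / 2 * norm d ^ 2 * norm u * s ^ 2"
  let ?h' = "\<lambda>s. u \<bullet> (hessian f (x + s *\<^sub>R d) *v d) - u \<bullet> (hessian f x *v d) - L * norm d ^ 2 * norm u * s"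
  have "?h 1 \<le> ?h 0"
  proof (rule DERIV_nonpos_imp_nonincreasing[where a = 0 and b = 1 and f = ?h])
    fix s :: real assume s: "0 \<le> s" "s \<le> 1"
    have D: "(?h has_real_derivative ?h' s) (at s)"
      by (rule derivative_eq_intros hessian_along_line f refl | simp)+
    have "u \<bullet> ((hessian f (x + s *\<^sub>R d) - hessian f x) *v d)
        \<le> norm u * norm ((hessian f (x + s *\<^sub>R d) - hessian f x) *v d)"
      by (rule norm_cauchy_schwarz)
    also have "\<dots> \<le> norm u * ((L * norm ((x + s *\<^sub>R d) - x)) * norm d)"
      by (intro mult_left_mono order_trans[OF norm_matrix_vector_le_opnorm] mult_right_mono lip) auto
    also have "\<dots> = L * norm d ^ 2 * norm u * s"
      using s by (simp add: power2_eq_square)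
    finally have "?h' s \<le> 0"
      by (simp add: matrix_vector_mult_diff_rdistrib inner_diff_right)
    with D show "\<exists>y. (?h has_real_derivative y) (at s) \<and> y \<le> 0" by blast
  qed simp
  then show ?thesis by (simp add: inner_diff_right)
qed

lemma hessian_lipschitz_gradient:
  fixes f :: "real^'n \<Rightarrow> real"
  assumes "\<And>y. gradient f differentiable (at y)"
    and "\<And>y z. opnorm (hessian f y - hessian f z) \<le> L * norm (y - z)"
  shows "norm (gradient f (x + d) - gradient f x - hessian f x *v d) \<le> L / 2 * norm d ^ 2"
proof -
  \<comment> \<open>Testing the remainder against itself turns the scalar bound into a norm bound
    after one factor is cancelled.\<close>
  let ?u = "gradient f (x + d) - gradient f x - hessian f x *v d"
  have "norm ?u * norm ?u \<le> L / 2 * norm d ^ 2 * norm ?u"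
    using hessian_lipschitz_gradient_inner[OF assms, of ?u x d]
    by (simp add: dot_square_norm power2_eq_square)
  \<comment> \<open>Covers a vanishing remainder, where nothing can be cancelled; the Lipschitz
    condition at two distinct points forces the sign.\<close>
  moreover have "0 \<le> L"
  proof -
    have "0 \<le> L * norm (((\<chi> i. 1) :: real^'n) - 0)"
      using assms(2) opnorm_nonneg order_trans by blast
    moreover have "0 < norm (((\<chi> i. 1) :: real^'n) - 0)"
      by (simp add: vec_eq_iff)
    ultimately show ?thesis by (simp add: zero_le_mult_iff)
  qed
  ultimately show ?thesis
    by (cases "norm ?u = 0") (simp, metis mult_right_le_imp_le norm_ge_zero order_less_le)
qed

text \<open>The second-order Taylor polynomial with cubic remainder \<open>L / 6\<close> is the
  cubic model with weight \<open>L\<close>.\<close>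

lemma hessian_lipschitz_upper_bound:
  fixes f :: "real^'n \<Rightarrow> real"
  assumes f: "\<And>y. f differentiable (at y)" "\<And>y. gradient f differentiable (at y)"
    and lip: "\<And>y z. opnorm (hessian f y - hessian f z) \<le> L * norm (y - z)"
  shows "f y \<le> f x + cubic_model (gradient f x) (hessian f x) x L y"
proof -
  define d where "d = y - x"
  let ?h = "\<lambda>s. f (x + s *\<^sub>R d) - s * (d \<bullet> gradient f x) - s ^ 2 / 2 * (d \<bullet> (hessian f x *v d)) - L / 6 * norm d ^ 3 * s ^ 3"
  let ?h' = "\<lambda>s. d \<bullet> gradient f (x + s *\<^sub>R d) - d \<bullet> gradient f x - s * (d \<bullet> (hessian f x *v d)) - L / 2 * norm d ^ 3 * s ^ 2"
  have "?h 1 \<le> ?h 0"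
  proof (rule DERIV_nonpos_imp_nonincreasing[where a = 0 and b = 1 and f = ?h])
    fix s :: real assume s: "0 \<le> s" "s \<le> 1"
    have D: "(?h has_real_derivative ?h' s) (at s)"
      by (rule derivative_eq_intros gradient_along_line f refl | simp)+
    have "?h' s \<le> 0"
      \<comment> \<open>The gradient bound with \<open>u = d\<close> and displacement
        \<open>s *\<^sub>R d\<close> is the sign of the derivative.\<close>
      using hessian_lipschitz_gradient_inner[OF f(2) lip, of d x "s *\<^sub>R d"] s
      by (simp add: inner_diff_right matrix_vector_mult_scaleR power_mult_distrib
          power2_eq_square power3_eq_cube algebra_simps)
    with D show "\<exists>y. (?h has_real_derivative y) (at s) \<and> y \<le> 0" by blast
  qed simp
  then show ?thesis
    by (simp add: cubic_model_def d_def inner_commute)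
qed

section \<open>The gradient of the cubic model\<close>

lemma has_derivative_norm_cubed:
  fixes y :: "'a::real_inner"
  shows "((\<lambda>y. norm y ^ 3) has_derivative (\<lambda>h. 3 * norm y * (h \<bullet> y))) (at y)"
proof (cases "y = 0")
  \<comment> \<open>The norm has no derivative at 0, but its cube divided by it is the square, which
    tends to 0.\<close>
  case True
  have "(\<lambda>h::'a. norm h ^ 3 / norm h) = (\<lambda>h. norm h ^ 2)"
    by (auto simp: power2_eq_square power3_eq_cube)
  moreover have "((\<lambda>h::'a. norm h ^ 2) \<longlongrightarrow> 0) (at 0)"
    by (auto intro!: tendsto_eq_intros)
  ultimately show ?thesis
    using True by (simp add: has_derivative_at)
next
  case False
  then show ?thesis
    using has_derivative_power[OF has_derivative_norm[OF False], of 3]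
    by (simp add: sgn_div_norm power2_eq_square field_simps)
qed

text \<open>Symmetry of \<open>H\<close> merges the two halves of the derivative of the quadratic
  form into \<open>H *v (y - x)\<close>.\<close>

lemma gradient_cubic_model:
  fixes g :: "real^'n"
  assumes sym: "transpose H = H"
  shows "gradient (cubic_model g H x s) y = g + H *v (y - x) + (s / 2 * norm (y - x)) *\<^sub>R (y - x)"
proof (rule gradient_eqI)
  have H: "((\<lambda>y. H *v (y - x)) has_derivative (\<lambda>h. H *v h)) (at y)"
    by (rule has_derivative_eq_rhs,
        rule bounded_linear.has_derivative[OF matrix_vector_mul_bounded_linear])
       (auto intro!: derivative_eq_intros)
  have d: "((\<lambda>y. y - x) has_derivative (\<lambda>h. h)) (at y)"
    by (auto intro!: derivative_eq_intros)
  have c: "((\<lambda>y. norm (y - x) ^ 3) has_derivative (\<lambda>h. 3 * norm (y - x) * (h \<bullet> (y - x)))) (at y)"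
    by (rule has_derivative_compose[OF d has_derivative_norm_cubed])
  have sym': "(H *v v) \<bullet> w = (H *v w) \<bullet> v" for v w
    by (metis dot_lmul_matrix inner_commute sym transpose_matrix_vector)
  have "(cubic_model g H x s has_derivative
      (\<lambda>h. g \<bullet> h + 1 / 2 * ((H *v (y - x)) \<bullet> h + (H *v h) \<bullet> (y - x)) + s / 6 * (3 * norm (y - x) * (h \<bullet> (y - x))))) (at y)"
    unfolding cubic_model_def
    by (intro has_derivative_add has_derivative_mult_right has_derivative_inner_right
        has_derivative_inner H d c)
  moreover have "g \<bullet> h + 1 / 2 * ((H *v (y - x)) \<bullet> h + (H *v h) \<bullet> (y - x)) + s / 6 * (3 * norm (y - x) * (h \<bullet> (y - x)))
      = h \<bullet> (g + H *v (y - x) + (s / 2 * norm (y - x)) *\<^sub>R (y - x))" for h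
    unfolding sym'[of h] by (simp add: inner_add_right inner_commute[of _ h])
  ultimately show "GDERIV (cubic_model g H x s) y :> g + H *v (y - x) + (s / 2 * norm (y - x)) *\<^sub>R (y - x)"
    unfolding gderiv_def by simp
qed

section \<open>From quadratically shrinking steps to a quadratic rate\<close>

text \<open>Eventually the steps decay geometrically, so each step length is comparable, up to a
  factor 2 either way, to the distance from its starting point to the limit. The recursion for steps
  then carries over to distances.\<close>

lemma quadratic_steps_imp_quadratic_convergence:
  fixes x :: "nat \<Rightarrow> 'a::banach"
  assumes K: "K > 0"
    and step: "\<And>t. t \<ge> N \<Longrightarrow> norm (x (t + 2) - x (t + 1)) \<le> K * norm (x (t + 1) - x t) ^ 2"
    and lim0: "(\<lambda>t. norm (x (t + 1) - x t)) \<longlonglongrightarrow> 0"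
  shows "convergent x \<and>
    (\<exists>D>0. \<forall>\<^sub>F t in sequentially. norm (x (t + 1) - lim x) \<le> D * norm (x t - lim x) ^ 2)"
proof -
  define d where "d t = norm (x (t + 1) - x t)" for t
  have d: "d t \<ge> 0" for t by (simp add: d_def)
  have dlim: "d \<longlonglongrightarrow> 0" using lim0 unfolding d_def .
  have stepd: "d (t + 1) \<le> K * d t ^ 2" if "t \<ge> N" for t
    using step[OF that] unfolding d_def by simp
  \<comment> \<open>Below this threshold the quadratic recursion makes each step at most a quarter
    of the preceding one.\<close>
  from K have "\<forall>\<^sub>F t in sequentially. d t < 1 / (4 * K)"
    by (intro order_tendstoD[OF dlim]) simp
  then obtain N' where N': "\<And>t. t \<ge> N' \<Longrightarrow> d t < 1 / (4 * K)"
    unfolding eventually_sequentially by blast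
  define M where "M = max N N'"
  have small: "K * d t \<le> 1 / 4" if "t \<ge> M" for t
    using N'[of t] that K by (simp add: M_def field_simps)
  have quarter: "d (t + 1) \<le> d t / 4" if "t \<ge> M" for t
    using stepd[of t] mult_right_mono[OF small[OF that] d[of t]] that
    by (simp add: M_def power2_eq_square)
  have tail: "norm (x (t + k) - x t) \<le> 2 * d t" if "t \<ge> M" for t k
    using that
  proof (induction k arbitrary: t)
    case 0
    then show ?case using d by simp
  next
    case (Suc k)
    have "norm (x (t + Suc k) - x t) \<le> norm (x ((t + 1) + k) - x (t + 1)) + norm (x (t + 1) - x t)"
      using norm_triangle_ineq[of "x (t + 1 + k) - x (t + 1)" "x (t + 1) - x t"] by simp
    also have "\<dots> \<le> 2 * d (t + 1) + d t"
      using Suc.IH[of "t + 1"] Suc.prems by (simp add: d_def)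
    also have "\<dots> \<le> 2 * d t" using quarter[of t] Suc.prems d[of t] by simp
    finally show ?case .
  qed
  have "Cauchy x"
  proof (rule CauchyI)
    fix e :: real assume e: "0 < e"
    then have "\<forall>\<^sub>F t in sequentially. d t < e / 4"
      by (intro order_tendstoD[OF dlim]) simp
    then obtain P where P: "\<And>t. t \<ge> P \<Longrightarrow> d t < e / 4"
      unfolding eventually_sequentially by blast
    let ?p = "max M P"
    have "norm (x m - x ?p) < e / 2" if "m \<ge> ?p" for m
      using tail[of ?p "m - ?p"] P[of ?p] that by simp
    then have "norm (x m - x n) < e" if "m \<ge> ?p" "n \<ge> ?p" for m n
      using that by (auto intro: norm_triangle_half_l[of "x m" "x ?p"])
    then show "\<exists>M. \<forall>m\<ge>M. \<forall>n\<ge>M. norm (x m - x n) < e" by blast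
  qed
  then have conv: "convergent x" by (rule Cauchy_convergent)
  then have L: "x \<longlonglongrightarrow> lim x" by (simp add: convergent_LIMSEQ_iff)
  have dist_lim: "norm (x t - lim x) \<le> 2 * d t" if "t \<ge> M" for t
  proof (rule LIMSEQ_le_const2)
    show "(\<lambda>k. norm (x t - x (t + k))) \<longlonglongrightarrow> norm (x t - lim x)"
      using LIMSEQ_ignore_initial_segment[OF L, of t]
      by (intro tendsto_intros) (simp add: add.commute)
    show "\<exists>N. \<forall>k\<ge>N. norm (x t - x (t + k)) \<le> 2 * d t"
      using tail[OF that] by (simp add: norm_minus_commute)
  qed
  \<comment> \<open>The constant is 2 (distance against step) times \<open>K\<close> times the
    square of 2 (step against distance).\<close>
  have "norm (x (t + 1) - lim x) \<le> 8 * K * norm (x t - lim x) ^ 2" if t: "t \<ge> M" for t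
  proof -
    have near: "norm (x (t + 1) - lim x) \<le> 2 * d (t + 1)" using dist_lim t by simp
    have "d t \<le> norm (x (t + 1) - lim x) + norm (x t - lim x)"
      unfolding d_def using norm_triangle_ineq4[of "x (t + 1) - lim x" "x t - lim x"] by simp
    \<comment> \<open>The distance at \<open>t + 1\<close> is at most \<open>2 * d (t + 1)\<close>,
      hence at most half of \<open>d t\<close>, and is absorbed on the left.\<close>
    with near quarter[OF t] have "d t \<le> 2 * norm (x t - lim x)" by simp
    then have "d t ^ 2 \<le> (2 * norm (x t - lim x)) ^ 2" using d by (intro power_mono)
    then have "K * d t ^ 2 \<le> K * (2 * norm (x t - lim x)) ^ 2" using K by simp
    with near stepd[of t] t show ?thesis
      by (simp add: M_def power_mult_distrib)
  qed
  then have "\<forall>\<^sub>F t in sequentially. norm (x (t + 1) - lim x) \<le> (8 * K) * norm (x t - lim x) ^ 2"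
    unfolding eventually_sequentially by blast
  moreover have "8 * K > 0" using K by simp
  ultimately show ?thesis using conv by blast
qed

section \<open>Estimates for a single step\<close>

lemma cubic_model_le_max_model: "cubic_model (g j) (H j) x s y \<le> max_model g H x s y"
  unfolding max_model_def by (rule Max_ge) auto

text \<open>Raising the weight of the Taylor bound from \<open>L\<close> to \<open>s\<close> gains
  \<open>(s - L) / 6\<close> times the cubed step, which is at least \<open>s / 12\<close> times it
  once \<open>s\<close> reaches \<open>2 * L\<close>. This is why large trial parameters are
  accepted.\<close>

lemma cubic_decrease:
  fixes f :: "real^'n \<Rightarrow> real"
  assumes f: "twice_cont_diff f"
    and lip: "\<And>y z. opnorm (hessian f y - hessian f z) \<le> L * norm (y - z)"
    and model: "cubic_model (gradient f x) (hessian f x) x s y \<le> 0"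
    and s: "2 * L \<le> s"
  shows "s / 12 * norm (y - x) ^ 3 \<le> f x - f y"
proof -
  have "f y \<le> f x + cubic_model (gradient f x) (hessian f x) x L y"
    using f lip unfolding twice_cont_diff_def by (intro hessian_lipschitz_upper_bound) auto
  also have "\<dots> = f x + cubic_model (gradient f x) (hessian f x) x s y + (L / 6 - s / 6) * norm (y - x) ^ 3"
    by (simp add: cubic_model_def algebra_simps)
  also have "\<dots> \<le> f x + 0 + (- (s / 12)) * norm (y - x) ^ 3"
    using s by (intro add_mono add_left_mono model mult_right_mono) auto
  finally show ?thesis by simp
qed

text \<open>Each true gradient at \<open>y\<close> is the model gradient plus a Taylor remainder
  minus the gradient of the cubic term. The last is the same for all \<open>j\<close>, so weights of
  sum 1 leave it unchanged, and all three parts are quadratic in the step.\<close>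

lemma stationarity_residual:
  fixes f :: "'m::finite \<Rightarrow> real^'n \<Rightarrow> real"
  assumes f: "\<And>j. twice_cont_diff (f j)"
    and lip: "\<And>j y z. opnorm (hessian (f j) y - hessian (f j) z) \<le> L * norm (y - z)"
    and sym: "\<And>j. transpose (hessian (f j) x) = hessian (f j) x"
    and l: "\<And>j. 0 \<le> l j" "(\<Sum>j\<in>UNIV. l j) = 1"
    and s: "0 \<le> s"
    and res: "norm (\<Sum>j\<in>UNIV. l j *\<^sub>R gradient (cubic_model (gradient (f j) x) (hessian (f j) x) x s) y)
       \<le> \<theta> * norm (y - x) ^ 2"
  shows "norm (\<Sum>j\<in>UNIV. l j *\<^sub>R gradient (f j) y) \<le> (\<theta> + s / 2 + L / 2) * norm (y - x) ^ 2"
proof -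
  let ?d = "y - x"
  let ?r = "\<lambda>j. gradient (f j) y - gradient (f j) x - hessian (f j) x *v ?d"
  let ?M = "\<Sum>j\<in>UNIV. l j *\<^sub>R gradient (cubic_model (gradient (f j) x) (hessian (f j) x) x s) y"
  have r: "norm (?r j) \<le> L / 2 * norm ?d ^ 2" for j
  proof -
    have "norm (gradient (f j) (x + ?d) - gradient (f j) x - hessian (f j) x *v ?d) \<le> L / 2 * norm ?d ^ 2"
      using f[of j] lip unfolding twice_cont_diff_def by (intro hessian_lipschitz_gradient) blast+
    then show ?thesis by simp
  qed
  let ?v = "(s / 2 * norm ?d) *\<^sub>R ?d"
  have cancel: "z = a + b + v + (z - a - b) - v" for z a b v :: "real^'n"
    by simp
  have "l j *\<^sub>R gradient (f j) y =
      l j *\<^sub>R gradient (cubic_model (gradient (f j) x) (hessian (f j) x) x s) y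
      + l j *\<^sub>R ?r j - l j *\<^sub>R ?v" for j
    unfolding gradient_cubic_model[OF sym] scaleR_add_right[symmetric] scaleR_diff_right[symmetric]
    by (rule arg_cong[where f = "scaleR (l j)"]) (rule cancel)
  then have "(\<Sum>j\<in>UNIV. l j *\<^sub>R gradient (f j) y) = (\<Sum>j\<in>UNIV.
      l j *\<^sub>R gradient (cubic_model (gradient (f j) x) (hessian (f j) x) x s) y
      + l j *\<^sub>R ?r j - l j *\<^sub>R ?v)"
    by (rule sum.cong[OF refl])
  also have "\<dots> = ?M + (\<Sum>j\<in>UNIV. l j *\<^sub>R ?r j) - (\<Sum>j\<in>UNIV. l j) *\<^sub>R ?v"
    by (simp only: sum.distrib sum_subtractf scaleR_sum_left)
  finally have eq: "(\<Sum>j\<in>UNIV. l j *\<^sub>R gradient (f j) y) = ?M + (\<Sum>j\<in>UNIV. l j *\<^sub>R ?r j) - ?v"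
    by (simp only: l(2) scaleR_one)
  have "norm (\<Sum>j\<in>UNIV. l j *\<^sub>R gradient (f j) y) \<le> norm ?M + norm (\<Sum>j\<in>UNIV. l j *\<^sub>R ?r j) + norm ?v"
    unfolding eq by (rule order_trans[OF norm_triangle_ineq4 add_right_mono[OF norm_triangle_ineq]])
  also have "\<dots> \<le> \<theta> * norm ?d ^ 2 + L / 2 * norm ?d ^ 2 + s / 2 * norm ?d ^ 2"
  proof (intro add_mono res)
    have "norm (\<Sum>j\<in>UNIV. l j *\<^sub>R ?r j) \<le> (\<Sum>j\<in>UNIV. l j * (L / 2 * norm ?d ^ 2))"
    proof (rule sum_norm_le)
      show "norm (l j *\<^sub>R ?r j) \<le> l j * (L / 2 * norm ?d ^ 2)" for j
        using mult_left_mono[OF r l(1)] l(1) by (simp only: norm_scaleR abs_of_nonneg)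
    qed
    also have "\<dots> = L / 2 * norm ?d ^ 2" by (simp only: sum_distrib_right[symmetric] l(2) mult_1)
    finally show "norm (\<Sum>j\<in>UNIV. l j *\<^sub>R ?r j) \<le> L / 2 * norm ?d ^ 2" .
    show "norm ((s / 2 * norm ?d) *\<^sub>R ?d) \<le> s / 2 * norm ?d ^ 2"
      using s by (simp add: power2_eq_square)
  qed
  finally show ?thesis by (simp only: distrib_right add.assoc add.left_commute add.commute)
qed

text \<open>The models are nonpositive one by one, so every convex combination of them is; this
  allows the weights to come from the preceding step. Dropping the cubic term, bounding the
  curvature below by \<open>\<mu>\<close> and applying Cauchy-Schwarz leaves one factor of the step
  length.\<close>

lemma step_le_residual:
  fixes g :: "'m::finite \<Rightarrow> real^'n"
  assumes l: "\<And>j. 0 \<le> l j" "(\<Sum>j\<in>UNIV. l j) = 1"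
    and model: "\<And>j. cubic_model (g j) (H j) x s y \<le> 0"
    and s: "0 \<le> s"
    and pos: "\<And>j. loewner_le (mat \<mu>) (H j)"
  shows "\<mu> / 2 * norm (y - x) \<le> norm (\<Sum>j\<in>UNIV. l j *\<^sub>R g j)"
proof -
  let ?d = "y - x"
  have mu: "mat \<mu> *v ?d = \<mu> *\<^sub>R ?d"
    by (simp add: matrix_vector_mult_def mat_def vec_eq_iff if_distrib if_distribR cong: if_cong)
  have "g j \<bullet> ?d + \<mu> / 2 * norm ?d ^ 2 \<le> 0" for j
  proof -
    have "\<mu> * norm ?d ^ 2 \<le> (H j *v ?d) \<bullet> ?d"
      using pos[of j] mu unfolding loewner_le_def
      by (metis inner_commute inner_scaleR_left power2_norm_eq_inner)
    moreover have "0 \<le> s / 6 * norm ?d ^ 3" using s by simp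
    ultimately show ?thesis using model[of j] unfolding cubic_model_def by linarith
  qed
  then have "(\<Sum>j\<in>UNIV. l j * (g j \<bullet> ?d + \<mu> / 2 * norm ?d ^ 2)) \<le> 0"
    using l(1) by (intro sum_nonpos) (simp add: mult_nonneg_nonpos)
  then have "(\<Sum>j\<in>UNIV. l j *\<^sub>R g j) \<bullet> ?d + \<mu> / 2 * norm ?d ^ 2 \<le> 0"
    by (simp only: distrib_left sum.distrib sum_distrib_right[symmetric] l(2) inner_sum_left
        inner_scaleR_left mult_1)
  then have "\<mu> / 2 * norm ?d * norm ?d \<le> (- (\<Sum>j\<in>UNIV. l j *\<^sub>R g j)) \<bullet> ?d"
    by (simp add: power2_eq_square)
  also have "\<dots> \<le> norm (\<Sum>j\<in>UNIV. l j *\<^sub>R g j) * norm ?d"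
    using norm_cauchy_schwarz[of "- (\<Sum>j\<in>UNIV. l j *\<^sub>R g j)" ?d] by simp
  finally show ?thesis
    by (cases "?d = 0") (auto dest: mult_right_le_imp_le)
qed

section \<open>Bounds on the regularization parameters\<close>

lemma powi_pred:
  fixes \<alpha> :: real
  assumes "0 < \<alpha>"
  shows "\<alpha> powi (int n - 1) = \<alpha> ^ n / \<alpha>"
  using assms by (simp add: power_int_diff)

text \<open>Powers of \<open>\<alpha>\<close> are unbounded, so the \<open>LEAST\<close> in
  \<open>first_trial\<close> is attained.\<close>

lemma first_trial:
  assumes "1 < \<alpha>" "0 < \<sigma> t"
  shows "\<sigma> 1 \<le> \<alpha> powi (int (first_trial \<alpha> \<sigma> t) - 1) * \<sigma> t"
  unfolding first_trial_def
proof (rule LeastI_ex)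
  obtain n where "\<sigma> 1 * \<alpha> / \<sigma> t < \<alpha> ^ n"
    using real_arch_pow[OF assms(1)] by blast
  then have "\<sigma> 1 \<le> \<alpha> powi (int n - 1) * \<sigma> t"
    using assms by (simp add: powi_pred field_simps)
  then show "\<exists>i. \<sigma> 1 \<le> \<alpha> powi (int i - 1) * \<sigma> t" by blast
qed

text \<open>The factor \<open>\<alpha>\<close> on the left absorbs the exponent
  \<open>int (it t) - 1\<close>, which is -1 when \<open>it t = 0\<close>.\<close>

lemma M_CRM_sigma_Suc:
  assumes "M_CRM F \<theta> \<alpha> \<kappa>G \<kappa>H x lam \<sigma> it g H xp lp" "1 \<le> t"
  shows "\<alpha> * \<sigma> (t + 1) = \<alpha> ^ it t * \<sigma> t"
proof -
  have "\<alpha> > 1" and "\<sigma> (t + 1) = \<alpha> powi (int (it t) - 1) * \<sigma> t"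
    using assms unfolding M_CRM_def by blast+
  then show ?thesis by (simp add: powi_pred)
qed

text \<open>The inequality met at \<open>first_trial\<close> persists at later trials, since the
  powers increase, and at \<open>it t\<close> it concerns \<open>\<sigma> (t + 1)\<close>.
  Positivity of \<open>\<sigma>\<close> from index 1 on follows.\<close>

lemma M_CRM_sigma_ge:
  assumes alg: "M_CRM F \<theta> \<alpha> \<kappa>G \<kappa>H x lam \<sigma> it g H xp lp" and "1 \<le> t"
  shows "\<sigma> 1 \<le> \<sigma> t"
  using \<open>1 \<le> t\<close>
proof (induction t rule: dec_induct)
  case (step t)
  have \<alpha>: "\<alpha> > 1" and \<sigma>1: "\<sigma> 1 > 0"
    and it: "first_trial \<alpha> \<sigma> t \<le> it t" and Suc: "\<sigma> (t + 1) = \<alpha> powi (int (it t) - 1) * \<sigma> t"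
    using alg step.hyps unfolding M_CRM_def by blast+
  have pos: "\<sigma> t > 0" using \<sigma>1 step.IH by simp
  have "\<sigma> 1 \<le> \<alpha> powi (int (first_trial \<alpha> \<sigma> t) - 1) * \<sigma> t"
    using \<alpha> pos by (rule first_trial)
  also have "\<dots> \<le> \<sigma> (t + 1)"
    unfolding Suc using it \<alpha> pos by (intro mult_right_mono power_int_increasing) auto
  finally show ?case by simp
qed simp

text \<open>If \<open>\<sigma>\<close> grows, then either the accepted trial was the first one, which is at most \<open>\<alpha>\<close> times
  too large by minimality, or the preceding trial was rejected and so was below \<open>B\<close>.\<close>
lemma M_CRM_sigma_le:
  assumes alg: "M_CRM F \<theta> \<alpha> \<kappa>G \<kappa>H x lam \<sigma> it g H xp lp"
    and acc: "\<And>t i. 1 \<le> t \<Longrightarrow> i \<in> {first_trial \<alpha> \<sigma> t..it t} \<Longrightarrow> B \<le> \<alpha> ^ i * \<sigma> t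
      \<Longrightarrow> accepted F (x (t - 1)) (x t) (\<sigma> t) (\<alpha> ^ i * \<sigma> t) (xp t i)"
    and "1 \<le> t"
  shows "\<sigma> t \<le> max (\<alpha> * \<sigma> 1) B"
  using \<open>1 \<le> t\<close>
proof (induction t rule: dec_induct)
  case base
  have "\<alpha> > 1" "\<sigma> 1 > 0" using alg unfolding M_CRM_def by blast+
  then show ?case by (simp add: le_max_iff_disj)
next
  case (step t)
  have \<alpha>: "\<alpha> > 1" and \<sigma>1: "\<sigma> 1 > 0" and it: "first_trial \<alpha> \<sigma> t \<le> it t"
    and rej: "\<And>i. i \<in> {first_trial \<alpha> \<sigma> t..it t} \<Longrightarrow>
      accepted F (x (t - 1)) (x t) (\<sigma> t) (\<alpha> ^ i * \<sigma> t) (xp t i) \<longleftrightarrow> i = it t"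
    using alg step.hyps unfolding M_CRM_def by blast+
  have Suc: "\<sigma> (t + 1) = \<alpha> ^ it t / \<alpha> * \<sigma> t"
    using M_CRM_sigma_Suc[OF alg step.hyps(1)] \<alpha> by (simp add: field_simps)
  have pos: "\<sigma> t > 0" using \<sigma>1 M_CRM_sigma_ge[OF alg step.hyps(1)] by simp
  show ?case
  proof (cases "it t")
    case 0
    then have "\<sigma> t = \<alpha> * \<sigma> (t + 1)" using Suc \<alpha> by simp
    moreover have "1 * \<sigma> (t + 1) \<le> \<alpha> * \<sigma> (t + 1)"
      using M_CRM_sigma_ge[OF alg, of "t + 1"] \<alpha> \<sigma>1 by (intro mult_right_mono) auto
    ultimately have "\<sigma> (t + 1) \<le> \<sigma> t" by simp
    then show ?thesis using step.IH by simp
  next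
    case (Suc k)
    \<comment> \<open>The new \<open>\<sigma>\<close> is the parameter of trial \<open>k\<close>,
      the one just before the accepted index.\<close>
    then have k: "\<sigma> (t + 1) = \<alpha> ^ k * \<sigma> t"
      using \<open>\<sigma> (t + 1) = _\<close> \<alpha> by simp
    show ?thesis
    proof (cases "first_trial \<alpha> \<sigma> t = it t")
      case True
      then have "\<not> \<sigma> 1 \<le> \<alpha> powi (int k - 1) * \<sigma> t"
        using not_less_Least[of k "\<lambda>i. \<sigma> 1 \<le> \<alpha> powi (int i - 1) * \<sigma> t"] Suc
        unfolding first_trial_def by simp
      then have "\<alpha> ^ k * \<sigma> t < \<alpha> * \<sigma> 1" using \<alpha> by (simp add: powi_pred field_simps)
      then show ?thesis using k by simp
    next
      case False
      then have "k \<in> {first_trial \<alpha> \<sigma> t..it t}" using it Suc by auto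
      then have "\<not> B \<le> \<alpha> ^ k * \<sigma> t" using rej acc step.hyps(1) Suc by fastforce
      then show ?thesis using k by simp
    qed
  qed
qed

section \<open>Descent of the energy\<close>

text \<open>The accepted parameter is \<open>\<alpha> * \<sigma> (t + 1)\<close>. One share
  \<open>\<sigma> (t + 1)\<close> enters the new energy; the rest is at least
  \<open>(\<alpha> - 1) * \<sigma> 1\<close> and is the gain.\<close>

lemma M_CRM_descent:
  assumes alg: "M_CRM F \<theta> \<alpha> \<kappa>G \<kappa>H x lam \<sigma> it g H xp lp" and t: "1 \<le> t"
  shows "obj F j (x (t + 1)) + \<sigma> (t + 1) / 12 * norm (x (t + 1) - x t) ^ 3
      + (\<alpha> - 1) * \<sigma> 1 / 12 * norm (x (t + 1) - x t) ^ 3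
    \<le> obj F j (x t) + \<sigma> t / 12 * norm (x t - x (t - 1)) ^ 3"
proof -
  let ?n = "norm (x (t + 1) - x t) ^ 3"
  have \<alpha>: "\<alpha> > 1" and "accepted F (x (t - 1)) (x t) (\<sigma> t) (\<alpha> ^ it t * \<sigma> t) (x (t + 1))"
    using alg t unfolding M_CRM_def by auto
  then have acc: "\<alpha> * \<sigma> (t + 1) / 12 * ?n - \<sigma> t / 12 * norm (x t - x (t - 1)) ^ 3
      \<le> obj F j (x t) - obj F j (x (t + 1))"
    unfolding accepted_def M_CRM_sigma_Suc[OF alg t, symmetric] by simp
  have "(\<alpha> - 1) * \<sigma> 1 / 12 * ?n \<le> (\<alpha> - 1) * \<sigma> (t + 1) / 12 * ?n"
    using M_CRM_sigma_ge[OF alg, of "t + 1"] \<alpha>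
    by (intro mult_right_mono divide_right_mono mult_left_mono) auto
  also have "\<dots> = \<alpha> * \<sigma> (t + 1) / 12 * ?n - \<sigma> (t + 1) / 12 * ?n"
    by (simp add: algebra_simps diff_divide_distrib)
  finally show ?thesis using acc by simp
qed

text \<open>The energy of one objective decreases and is bounded below, so its decrements tend to 0,
  and they dominate a constant times the cubed steps.\<close>

lemma M_CRM_steps_tendsto_0:
  assumes alg: "M_CRM F \<theta> \<alpha> \<kappa>G \<kappa>H x lam \<sigma> it g H xp lp" and A2: "A2 F"
  shows "(\<lambda>t. norm (x (t + 1) - x t)) \<longlonglongrightarrow> 0"
proof -
  obtain j :: 'b where True by simp
  obtain b where b: "\<And>y. b \<le> obj F j y" using A2 unfolding A2_def by blast
  have \<alpha>: "\<alpha> > 1" and \<sigma>1: "\<sigma> 1 > 0" using alg unfolding M_CRM_def by blast+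
  define c where "c = (\<alpha> - 1) * \<sigma> 1 / 12"
  have c: "c > 0" using \<alpha> \<sigma>1 by (simp add: c_def)
  \<comment> \<open>Shifted by one: \<open>\<Phi> n\<close> is the energy at \<open>n + 1\<close>,
    because the algorithm starts at index 1.\<close>
  define \<Phi> where "\<Phi> n = obj F j (x (n + 1)) + \<sigma> (n + 1) / 12 * norm (x (n + 1) - x n) ^ 3" for n
  have dec: "\<Phi> (Suc n) + c * norm (x (n + 2) - x (n + 1)) ^ 3 \<le> \<Phi> n" for n
    using M_CRM_descent[OF alg, of "n + 1" j] by (simp add: \<Phi>_def c_def)
  have "\<Phi> (Suc n) \<le> \<Phi> n" for n
    using dec[of n] c by (smt (verit) mult_nonneg_nonneg norm_ge_zero zero_le_power)
  then have "decseq \<Phi>" by (rule decseq_SucI)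
  moreover have "b \<le> \<Phi> n" for n
  proof -
    have "0 \<le> \<sigma> (n + 1) / 12 * norm (x (n + 1) - x n) ^ 3"
      using M_CRM_sigma_ge[OF alg, of "n + 1"] \<sigma>1 by simp
    then show ?thesis using b[of "x (n + 1)"] by (simp add: \<Phi>_def)
  qed
  ultimately obtain l where l: "\<Phi> \<longlonglongrightarrow> l" using decseq_convergent by blast
  have "(\<lambda>n. \<Phi> n - \<Phi> (Suc n)) \<longlonglongrightarrow> 0"
    using tendsto_diff[OF l LIMSEQ_Suc[OF l]] by simp
  then have upper: "(\<lambda>n. (\<Phi> n - \<Phi> (Suc n)) / c) \<longlonglongrightarrow> 0"
    by (rule tendsto_divide_zero)
  have bound: "norm (x (n + 2) - x (n + 1)) ^ 3 \<le> (\<Phi> n - \<Phi> (Suc n)) / c" for n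
    using dec[of n] c by (simp add: pos_le_divide_eq mult.commute[of c])
  have "(\<lambda>n. norm (x (n + 2) - x (n + 1)) ^ 3) \<longlonglongrightarrow> 0"
    by (rule tendsto_sandwich[OF _ _ tendsto_const upper]) (use bound in auto)
  then have "(\<lambda>n. norm (x (Suc n + 1) - x (Suc n))) \<longlonglongrightarrow> 0" by (simp add: power_tendsto_0_iff)
  then show ?thesis by (rule LIMSEQ_imp_Suc)
qed

text \<open>The energy descent is iterated from \<open>t0\<close> and the cubic term at
  \<open>t\<close> dropped. When the cubic term at \<open>t0\<close> is at most the one at 1, this
  is the level set of \<open>A3\<close>.\<close>

lemma M_CRM_level:
  assumes alg: "M_CRM F \<theta> \<alpha> \<kappa>G \<kappa>H x lam \<sigma> it g H xp lp" and t0: "1 \<le> t0" "t0 \<le> t"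
  shows "obj F j (x t) \<le> obj F j (x t0) + \<sigma> t0 / 12 * norm (x t0 - x (t0 - 1)) ^ 3"
proof -
  have \<alpha>: "\<alpha> > 1" and \<sigma>1: "\<sigma> 1 > 0" using alg unfolding M_CRM_def by blast+
  have "obj F j (x t) + \<sigma> t / 12 * norm (x t - x (t - 1)) ^ 3
      \<le> obj F j (x t0) + \<sigma> t0 / 12 * norm (x t0 - x (t0 - 1)) ^ 3"
    using t0(2)
  proof (induction t rule: dec_induct)
    case (step t)
    have "0 \<le> (\<alpha> - 1) * \<sigma> 1 / 12 * norm (x (t + 1) - x t) ^ 3" using \<alpha> \<sigma>1 by simp
    then show ?case using M_CRM_descent[OF alg, of t j] step t0(1) by simp
  qed simp
  moreover have "0 \<le> \<sigma> t / 12 * norm (x t - x (t - 1)) ^ 3"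
    using M_CRM_sigma_ge[OF alg, of t] t0 \<sigma>1 by simp
  ultimately show ?thesis by simp
qed

section \<open>Quadratic convergence with exact derivatives\<close>

theorem theorem3p8:
  fixes F :: "real^'n \<Rightarrow> real^'m"
    and L :: "'m \<Rightarrow> real"
    and \<theta> \<alpha> \<kappa>G \<kappa>H \<mu> :: real
    and x :: "nat \<Rightarrow> real^'n" and lam :: "nat \<Rightarrow> real^'m"
    and \<sigma> :: "nat \<Rightarrow> real" and it :: "nat \<Rightarrow> nat"
    and g :: "nat \<Rightarrow> nat \<Rightarrow> 'm \<Rightarrow> real^'n" and H :: "nat \<Rightarrow> nat \<Rightarrow> 'm \<Rightarrow> real^'n^'n"
    and xp :: "nat \<Rightarrow> nat \<Rightarrow> real^'n" and lp :: "nat \<Rightarrow> nat \<Rightarrow> real^'m"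
    and t0 :: nat
  assumes C2: "\<And>j. twice_cont_diff (obj F j)"
    and alg: "M_CRM F \<theta> \<alpha> \<kappa>G \<kappa>H x lam \<sigma> it g H xp lp"
    and exact_gradient: "\<And>t i j. 1 \<le> t \<Longrightarrow> i \<in> {first_trial \<alpha> \<sigma> t..it t}
           \<Longrightarrow> g t i j = gradient (obj F j) (x t)"
    and exact_hessian: "\<And>t i j. 1 \<le> t \<Longrightarrow> i \<in> {first_trial \<alpha> \<sigma> t..it t}
           \<Longrightarrow> H t i j = hessian (obj F j) (x t)"
    and A1: "A1 F L"
    and A2: "A2 F"
    and A3: "\<mu> > 0" "A3 F x \<sigma> \<mu> t0"
    and t0: "1 \<le> t0" "\<sigma> t0 * norm (x t0 - x (t0 - 1)) ^ 3 \<le> \<sigma> 1 * norm (x 1 - x 0) ^ 3"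
  shows "convergent x \<and>
    (\<exists>D>0. \<forall>\<^sub>F t in sequentially. norm (x (t + 1) - lim x) \<le> D * norm (x t - lim x) ^ 2)"
proof -
  have pos: "\<sigma> 1 > 0" "\<theta> \<ge> 0" "\<alpha> > 1" using alg unfolding M_CRM_def by blast+
  define B where "B = Max (range L)"
  have lip: "opnorm (hessian (obj F j) y - hessian (obj F j) z) \<le> B * norm (y - z)" for j y z
  proof -
    have "L j \<le> B" unfolding B_def by (rule Max_ge) auto
    then show ?thesis using A1 unfolding A1_def by (meson mult_right_mono norm_ge_zero order_trans)
  qed
  have trial: "approx_step F \<kappa>G \<kappa>H (\<alpha> powi (int i - 1)) (x (t - 1)) (x t)
        (\<lambda>j. gradient (obj F j) (x t)) (\<lambda>j. hessian (obj F j) (x t))"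
      "subproblem_step \<theta> (x t) (\<alpha> ^ i * \<sigma> t)
        (\<lambda>j. gradient (obj F j) (x t)) (\<lambda>j. hessian (obj F j) (x t)) (xp t i) (lp t i)"
    if "1 \<le> t" "i \<in> {first_trial \<alpha> \<sigma> t..it t}" for t i
  proof -
    have "g t i = (\<lambda>j. gradient (obj F j) (x t))" "H t i = (\<lambda>j. hessian (obj F j) (x t))"
      using exact_gradient[OF that] exact_hessian[OF that] by auto
    moreover have "approx_step F \<kappa>G \<kappa>H (\<alpha> powi (int i - 1)) (x (t - 1)) (x t) (g t i) (H t i)"
      "subproblem_step \<theta> (x t) (\<alpha> ^ i * \<sigma> t) (g t i) (H t i) (xp t i) (lp t i)"
      using alg that unfolding M_CRM_def by blast+
    ultimately show "approx_step F \<kappa>G \<kappa>H (\<alpha> powi (int i - 1)) (x (t - 1)) (x t)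
        (\<lambda>j. gradient (obj F j) (x t)) (\<lambda>j. hessian (obj F j) (x t))"
      "subproblem_step \<theta> (x t) (\<alpha> ^ i * \<sigma> t)
        (\<lambda>j. gradient (obj F j) (x t)) (\<lambda>j. hessian (obj F j) (x t)) (xp t i) (lp t i)"
      by simp_all
  qed
  have model: "cubic_model (gradient (obj F j) (x t)) (hessian (obj F j) (x t)) (x t) (\<alpha> ^ i * \<sigma> t) (xp t i) \<le> 0"
    if "1 \<le> t" "i \<in> {first_trial \<alpha> \<sigma> t..it t}" for t i j
    using trial(2)[OF that]
      cubic_model_le_max_model[of "\<lambda>j. gradient (obj F j) (x t)" j "\<lambda>j. hessian (obj F j) (x t)"]
    unfolding subproblem_step_def by (meson order_trans)
  have \<sigma>pos: "\<sigma> t > 0" if "1 \<le> t" for t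
    using M_CRM_sigma_ge[OF alg that] pos by simp
  have acc: "accepted F (x (t - 1)) (x t) (\<sigma> t) (\<alpha> ^ i * \<sigma> t) (xp t i)"
    if t: "1 \<le> t" and i: "i \<in> {first_trial \<alpha> \<sigma> t..it t}" and large: "2 * B \<le> \<alpha> ^ i * \<sigma> t" for t i
    unfolding accepted_def
  proof
    fix j
    have "0 \<le> \<sigma> t / 12 * norm (x t - x (t - 1)) ^ 3" using \<sigma>pos[OF t] by simp
    then show "\<alpha> ^ i * \<sigma> t / 12 * norm (xp t i - x t) ^ 3 - \<sigma> t / 12 * norm (x t - x (t - 1)) ^ 3
        \<le> obj F j (x t) - obj F j (xp t i)"
      using cubic_decrease[OF C2 lip model[OF t i] large, of j] by simp
  qed
  \<comment> \<open>\<open>2 * B\<close> is the acceptance threshold of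
    \<open>cubic_decrease\<close> for the common Lipschitz constant \<open>B\<close>.\<close>
  define S where "S = max (\<alpha> * \<sigma> 1) (2 * B)"
  have \<sigma>S: "\<sigma> t \<le> S" if "1 \<le> t" for t
    unfolding S_def using M_CRM_sigma_le[OF alg acc that] .
  have S: "S > 0" unfolding S_def using pos by (simp add: less_max_iff_disj)
  \<comment> \<open>\<open>\<alpha> * S\<close> bounds the accepted parameter
    \<open>\<alpha> * \<sigma> (t + 1)\<close>; the absolute value makes positivity
    immediate.\<close>
  define C where "C = \<theta> + \<alpha> * S / 2 + \<bar>B\<bar> / 2"
  have C: "C > 0" using pos S by (simp add: C_def add_nonneg_pos add_pos_nonneg)
  have next_step: "it t \<in> {first_trial \<alpha> \<sigma> t..it t}" "x (t + 1) = xp t (it t)" if "1 \<le> t" for t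
    using alg that unfolding M_CRM_def by auto
  have step: "norm (x (t + 2) - x (t + 1)) \<le> (2 * C / \<mu>) * norm (x (t + 1) - x t) ^ 2" if t: "t \<ge> t0" for t
  proof -
    have t1: "1 \<le> t" "1 \<le> t + 1" using t t0(1) by simp_all
    let ?l = "\<lambda>j. lp t (it t) $ j"
    have sub: "subproblem_step \<theta> (x t) (\<alpha> ^ it t * \<sigma> t)
        (\<lambda>j. gradient (obj F j) (x t)) (\<lambda>j. hessian (obj F j) (x t)) (x (t + 1)) (lp t (it t))"
      using trial(2)[OF t1(1) next_step(1)[OF t1(1)]] next_step(2)[OF t1(1)] by simp
    then have l: "0 \<le> ?l j" "(\<Sum>j\<in>UNIV. ?l j) = 1" for j
      unfolding subproblem_step_def by blast+
    \<comment> \<open>The algorithm demands symmetric matrices, and here these are the Hessians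
      themselves.\<close>
    have sym: "transpose (hessian (obj F j) (x t)) = hessian (obj F j) (x t)" for j
      using trial(1)[OF t1(1) next_step(1)[OF t1(1)]] unfolding approx_step_def by blast
    have "norm (\<Sum>j\<in>UNIV. ?l j *\<^sub>R gradient (obj F j) (x (t + 1)))
        \<le> (\<theta> + \<alpha> ^ it t * \<sigma> t / 2 + B / 2) * norm (x (t + 1) - x t) ^ 2"
      using sub pos(3) \<sigma>pos[OF t1(1)] unfolding subproblem_step_def
      by (intro stationarity_residual[OF C2 lip sym l]) auto
    also have "\<dots> \<le> C * norm (x (t + 1) - x t) ^ 2"
    proof (rule mult_right_mono)
      have "\<alpha> ^ it t * \<sigma> t \<le> \<alpha> * S"
        unfolding M_CRM_sigma_Suc[OF alg t1(1), symmetric] using \<sigma>S[OF t1(2)] pos(3) by simp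
      then show "\<theta> + \<alpha> ^ it t * \<sigma> t / 2 + B / 2 \<le> C" unfolding C_def by linarith
    qed simp
    finally have res: "norm (\<Sum>j\<in>UNIV. ?l j *\<^sub>R gradient (obj F j) (x (t + 1)))
        \<le> C * norm (x (t + 1) - x t) ^ 2" .
    have "loewner_le (mat \<mu>) (hessian (obj F j) (x (t + 1)))" for j
    proof -
      have "obj F j (x (t + 1)) \<le> obj F j (x t0) + \<sigma> 1 / 12 * norm (x 1 - x 0) ^ 3"
        using M_CRM_level[OF alg t0(1), of "t + 1" j] t t0(2) by simp
      then show ?thesis using A3(2) unfolding A3_def by blast
    qed
    \<comment> \<open>The multipliers \<open>?l\<close> belong to step \<open>t\<close>, the models
      to step \<open>t + 1\<close>: the residual just bounded thus controls the next step.\<close>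
    then have "\<mu> / 2 * norm (x (t + 2) - x (t + 1)) \<le> norm (\<Sum>j\<in>UNIV. ?l j *\<^sub>R gradient (obj F j) (x (t + 1)))"
      using model[OF t1(2) next_step(1)[OF t1(2)]] next_step(2)[OF t1(2)] \<sigma>pos[OF t1(2)] pos(3)
      by (intro step_le_residual[OF l, where H = "\<lambda>j. hessian (obj F j) (x (t + 1))"
            and s = "\<alpha> ^ it (t + 1) * \<sigma> (t + 1)"]) auto
    with res have "\<mu> / 2 * norm (x (t + 2) - x (t + 1)) \<le> C * norm (x (t + 1) - x t) ^ 2"
      by (rule order_trans[rotated])
    then show ?thesis using A3(1) by (simp add: field_simps)
  qed
  show ?thesis
    using A3(1) C step M_CRM_steps_tendsto_0[OF alg A2]
    by (intro quadratic_steps_imp_quadratic_convergence[of "2 * C / \<mu>" t0]) auto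
qed

end
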